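(* Let $\pi$ be a policy on a finite state space $\mathcal{S}$ whose induced Markov chain with transition matrix $P^\pi$ is irreducible and aperiodic, with stationary distribution $\mu^\pi$, and let $\lambda\in[0,1)$. Let $\Phi\in\mathbb{R}^{|\mathcal{S}|\times d}$ have full column rank. Then the solution set of the projected Bellman equation $\Phi\theta=\Pi_{D,W_\Phi}\mathcal{T}^{(\lambda)}(\Phi\theta)$ is $\mathcal{L}_{\Phi,e}:=\theta^*+S_{\Phi,e}$, where $\theta^*\in E_{\Phi,e}$ is the unique solution of $\Phi\theta=\Pi_{D,W_{E_{\Phi,e}}}\mathcal{T}^{(\lambda)}(\Phi\theta)$.
   Context: $\mathcal{R}^\pi\in\mathbb{R}^{|\mathcal{S}|}$ is the reward vector under $\pi$, $r(\pi)=(\mu^\pi)^\top\mathcal{R}^\pi$, $e$ the all-ones vector. Bellman operator $\mathcal{T}(v)=\mathcal{R}^\pi-r(\pi)e+P^\pi v$; $\mathcal{T}^m$ is its $m$-fold composition; $\mathcal{T}^{(\lambda)}(v)=(1-\lambda)\sum_{m=0}^\infty\lambda^m\mathcal{T}^{m+1}(v)$. $D=\mathrm{diag}(\mu^\pi)$, $\|x\|_D=\sqrt{x^\top Dx}$. $W_\Phi=\{\Phi\theta:\theta\in\mathbb{R}^d\}$ and $\Pi_{D,W}$ denotes the $\|\cdot\|_D$-orthogonal projection onto a subspace $W$. $S_{\Phi,e}=\mathrm{span}\{\theta\in\mathbb{R}^d:\Phi\theta=e\}$ (equal to $\{c\theta_e:c\in\mathbb{R}\}$ if some $\theta_e$ satisfies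 $\Phi\theta_e=e$, and $\{0\}$ otherwise); $E_{\Phi,e}$ is the orthogonal complement of $S_{\Phi,e}$ in $\mathbb{R}^d$; $W_{E_{\Phi,e}}=\{\Phi\theta:\theta\in E_{\Phi,e}\}$. *)

theory Defs
  imports "HOL-Analysis.Analysis"
begin

text \<open>States are the elements of a finite type 's; features are indexed by a finite type 'd.
Vectors in R^|S| are real^'s, matrices P :: real^'s^'s (row i = transitions out of state i),
Phi :: real^'d^'s (|S| x d).\<close>

definition mat_pow :: "real^'s^'s \<Rightarrow> nat \<Rightarrow> real^'s^'s" where
  "mat_pow P n = ((\<lambda>A. A ** P) ^^ n) (mat 1)"

definition stochastic :: "real^'s^'s \<Rightarrow> bool" where
  "stochastic P \<longleftrightarrow> (\<forall>i j. P $ i $ j \<ge> 0) \<and> (\<forall>i. (\<Sum>j\<in>UNIV. P $ i $ j) = 1)"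

definition irreducible :: "real^'s^'s \<Rightarrow> bool" where
  "irreducible P \<longleftrightarrow> (\<forall>i j. \<exists>n. mat_pow P n $ i $ j > 0)"

definition period :: "real^'s^'s \<Rightarrow> 's \<Rightarrow> nat" where
  "period P i = Gcd {n. n > 0 \<and> mat_pow P n $ i $ i > 0}"

definition aperiodic :: "real^'s^'s \<Rightarrow> bool" where
  "aperiodic P \<longleftrightarrow> (\<forall>i. period P i = 1)"

definition stationary_dist :: "real^'s^'s \<Rightarrow> real^'s \<Rightarrow> bool" where
  "stationary_dist P \<mu> \<longleftrightarrow> (\<forall>i. \<mu> $ i \<ge> 0) \<and> (\<Sum>i\<in>UNIV. \<mu> $ i) = 1 \<and> \<mu> v* P = \<mu>"

text \<open>average reward r(pi) = mu^T R\<close>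
definition avg_reward :: "real^'s \<Rightarrow> real^'s \<Rightarrow> real" where
  "avg_reward \<mu> R = \<mu> \<bullet> R"

text \<open>Bellman operator T(v) = R - r(pi) e + P v\<close>
definition bellman :: "real^'s^'s \<Rightarrow> real^'s \<Rightarrow> real^'s \<Rightarrow> real^'s \<Rightarrow> real^'s" where
  "bellman P \<mu> R v = R - avg_reward \<mu> R *\<^sub>R (1::real^'s) + P *v v"

text \<open>T^(lambda)(v) = (1-lambda) sum_{m>=0} lambda^m T^{m+1}(v)\<close>
definition bellman_lambda :: "real \<Rightarrow> real^'s^'s \<Rightarrow> real^'s \<Rightarrow> real^'s \<Rightarrow> real^'s \<Rightarrow> real^'s" where
  "bellman_lambda lam P \<mu> R v =
     (1 - lam) *\<^sub>R (\<Sum>m. (lam ^ m) *\<^sub>R ((bellman P \<mu> R ^^ (m + 1)) v))"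

text \<open>D-weighted inner product <x,y>_D = x^T diag(mu) y\<close>
definition innerD :: "real^'s \<Rightarrow> real^'s \<Rightarrow> real^'s \<Rightarrow> real" where
  "innerD \<mu> x y = (\<Sum>i\<in>UNIV. \<mu> $ i * x $ i * y $ i)"

text \<open>||.||_D-orthogonal projection onto a subspace W\<close>
definition projD :: "real^'s \<Rightarrow> (real^'s) set \<Rightarrow> real^'s \<Rightarrow> real^'s" where
  "projD \<mu> W x = (THE y. y \<in> W \<and> (\<forall>w\<in>W. innerD \<mu> (x - y) w = 0))"

definition W_span :: "real^'d^'s \<Rightarrow> (real^'d) set \<Rightarrow> (real^'s) set" where
  "W_span \<Phi> E = (\<lambda>\<theta>. \<Phi> *v \<theta>) ` E"

definition S_Phi_e :: "real^'d^'s \<Rightarrow> (real^'d) set" where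
  "S_Phi_e \<Phi> = span {\<theta>. \<Phi> *v \<theta> = (1::real^'s)}"

definition E_Phi_e :: "real^'d^'s \<Rightarrow> (real^'d) set" where
  "E_Phi_e \<Phi> = {\<theta>. \<forall>s\<in>S_Phi_e \<Phi>. \<theta> \<bullet> s = 0}"

end

theory Submission
  imports Defs
begin

(*
  T^(lambda) is affine: T^(lambda)(v + u) = T^(lambda) v + P^(lambda) u, where
  P^(lambda) = (1 - lambda) sum_m lambda^m P^(m+1) fixes e, is nonexpansive in the D-norm,
  and mu^T T^(lambda) v = mu^T v.  Irreducibility makes mu > 0, so the D-projection onto a
  subspace is well defined.  Let W be a subspace with e \<notin> W.  If v \<in> W and
  v = Pi_W (P^(lambda) v), then Pythagoras and nonexpansiveness force P^(lambda) v = v,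
  hence P v = v, so v is constant by irreducibility and therefore 0.  Thus
  v \<mapsto> v - Pi_W (P^(lambda) v) is injective, hence bijective, on W, and the projected
  equation has exactly one solution in W; for W = W_{E_{Phi,e}} and injective Phi this gives theta*.
  Adding s \<in> S_{Phi,e} to theta adds a multiple of e to Phi theta and leaves the residual
  T^(lambda)(Phi theta) - Phi theta unchanged.  The residual is D-orthogonal to e, so it is
  D-orthogonal to W_Phi = W_{E_{Phi,e}} + span {e} iff it is D-orthogonal to W_{E_{Phi,e}}.
*)

section \<open>The lambda-averaged Bellman operator\<close>

lemma summable_real_times_power:
  fixes x :: real
  assumes "\<bar>x\<bar> < 1"
  shows "summable (\<lambda>n. real n * x ^ n)"
proof -
  have "(\<lambda>n. real n / real (Suc n)) \<longlonglongrightarrow> 1"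
    using LIMSEQ_n_over_Suc_n by simp
  then have "conv_radius (\<lambda>n. real n) = 1"
    by (intro conv_radius_ratio_limit_nonzero) simp_all
  then show ?thesis
    using assms by (intro summable_in_conv_radius) simp
qed

lemma summable_power_scaleR_linear_growth:
  fixes f :: "nat \<Rightarrow> 'a::banach"
  assumes "0 \<le> lam" "lam < 1" "\<And>n. norm (f n) \<le> A * real n + B"
  shows "summable (\<lambda>n. lam ^ n *\<^sub>R f n)"
proof (rule summable_comparison_test)
  show "\<exists>N. \<forall>n\<ge>N. norm (lam ^ n *\<^sub>R f n) \<le> A * (real n * lam ^ n) + B * lam ^ n"
    using assms mult_left_mono[OF assms(3), of "lam ^ _"] by (auto simp: algebra_simps)
  show "summable (\<lambda>n. A * (real n * lam ^ n) + B * lam ^ n)"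
    using assms by (intro summable_add summable_mult summable_real_times_power summable_geometric) auto
qed

lemma linear_suminf:
  fixes f :: "nat \<Rightarrow> 'a::real_vector \<Rightarrow> 'b::real_normed_vector"
  assumes "\<And>n. linear (f n)" "\<And>x. summable (\<lambda>n. f n x)"
  shows "linear (\<lambda>x. \<Sum>n. f n x)"
proof (rule linearI)
  fix x y and c :: real
  show "(\<Sum>n. f n (x + y)) = (\<Sum>n. f n x) + (\<Sum>n. f n y)"
    by (simp add: linear_add[OF assms(1)] suminf_add[OF assms(2) assms(2)])
  show "(\<Sum>n. f n (c *\<^sub>R x)) = c *\<^sub>R (\<Sum>n. f n x)"
    by (simp add: linear_cmul[OF assms(1)] suminf_scaleR_right[OF assms(2)])
qed

lemma linear_funpow:
  fixes f :: "'a::real_vector \<Rightarrow> 'a"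
  assumes "linear f"
  shows "linear (f ^^ n)"
proof (induction n)
  case 0
  show ?case by (simp add: id_def real_vector.linear_ident)
next
  case (Suc n)
  show ?case using linear_compose[OF Suc assms] by (simp only: funpow.simps(2))
qed

lemma stochastic_mult_one:
  assumes "stochastic P"
  shows "P *v 1 = 1"
  using assms by (simp add: vec_eq_iff matrix_vector_mult_def stochastic_def)

lemma stochastic_mult_abs_le:
  assumes "stochastic P" "\<And>j. \<bar>u $ j\<bar> \<le> B"
  shows "\<bar>(P *v u) $ i\<bar> \<le> B"
proof -
  have "\<bar>(P *v u) $ i\<bar> \<le> (\<Sum>j\<in>UNIV. \<bar>P $ i $ j * u $ j\<bar>)"
    unfolding matrix_vector_mult_def by (simp add: sum_abs)
  also have "\<dots> \<le> (\<Sum>j\<in>UNIV. P $ i $ j * B)"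
    using assms unfolding stochastic_def by (intro sum_mono) (simp add: abs_mult mult_left_mono)
  also have "\<dots> = B"
    using assms unfolding stochastic_def by (simp add: sum_distrib_right[symmetric])
  finally show ?thesis .
qed

lemma bellman_iterate_abs_le:
  assumes "stochastic P" "\<And>j. \<bar>(R - avg_reward \<mu> R *\<^sub>R 1) $ j\<bar> \<le> A" "\<And>j. \<bar>v $ j\<bar> \<le> B"
  shows "\<bar>((bellman P \<mu> R ^^ n) v) $ i\<bar> \<le> A * real n + B"
proof (induction n arbitrary: i)
  case 0
  show ?case using assms(3) by simp
next
  case (Suc n)
  have "\<bar>(P *v (bellman P \<mu> R ^^ n) v) $ i\<bar> \<le> A * real n + B"
    using Suc stochastic_mult_abs_le[OF assms(1)] by blast
  moreover have "(bellman P \<mu> R ^^ Suc n) v = (R - avg_reward \<mu> R *\<^sub>R 1) + P *v (bellman P \<mu> R ^^ n) v"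
    by (simp add: bellman_def[of P \<mu> R "(bellman P \<mu> R ^^ n) v"])
  ultimately show ?case
    using assms(2)[of i] abs_triangle_ineq[of "(R - avg_reward \<mu> R *\<^sub>R 1) $ i" "(P *v (bellman P \<mu> R ^^ n) v) $ i"]
    by (simp add: distrib_left)
qed

lemma summable_bellman_iterates:
  fixes P :: "real^'s^'s"
  assumes "stochastic P" "0 \<le> lam" "lam < 1"
  shows "summable (\<lambda>m. lam ^ m *\<^sub>R (bellman P \<mu> R ^^ (m + 1)) v)"
proof (rule summable_power_scaleR_linear_growth[OF assms(2,3)])
  define A where "A = (\<Sum>j\<in>UNIV. \<bar>(R - avg_reward \<mu> R *\<^sub>R 1) $ j\<bar>)"
  define B where "B = (\<Sum>j\<in>UNIV. \<bar>v $ j\<bar>)"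
  fix m
  have "\<bar>((bellman P \<mu> R ^^ (m + 1)) v) $ i\<bar> \<le> A * real (m + 1) + B" for i
    by (rule bellman_iterate_abs_le[OF assms(1)]) (auto simp: A_def B_def intro: member_le_sum)
  then have "norm ((bellman P \<mu> R ^^ (m + 1)) v) \<le> (\<Sum>i\<in>(UNIV::'s set). A * real (m + 1) + B)"
    by (intro order_trans[OF norm_le_l1_cart] sum_mono)
  then show "norm ((bellman P \<mu> R ^^ (m + 1)) v) \<le> (CARD('s) * A) * real m + CARD('s) * (A + B)"
    by (simp add: algebra_simps)
qed

lemma bellman_zero_reward: "bellman P \<mu> 0 = (*v) P"
  by (simp add: fun_eq_iff bellman_def avg_reward_def)

lemma summable_matrix_power_series:
  assumes "stochastic P" "0 \<le> lam" "lam < 1"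
  shows "summable (\<lambda>m. lam ^ m *\<^sub>R ((*v) P ^^ (m + 1)) u)"
  using summable_bellman_iterates[OF assms, of _ 0] by (simp only: bellman_zero_reward)

lemma bellman_iterate_add:
  "(bellman P \<mu> R ^^ n) (v + u) = (bellman P \<mu> R ^^ n) v + ((*v) P ^^ n) u"
  by (induction n) (auto simp: bellman_def matrix_vector_right_distrib)

definition geometric_mix :: "real \<Rightarrow> real^'s^'s \<Rightarrow> real^'s \<Rightarrow> real^'s" where
  "geometric_mix lam P u = (1 - lam) *\<^sub>R (\<Sum>m. lam ^ m *\<^sub>R ((*v) P ^^ (m + 1)) u)"

lemma bellman_lambda_add:
  fixes P :: "real^'s^'s"
  assumes "stochastic P" "0 \<le> lam" "lam < 1"
  shows "bellman_lambda lam P \<mu> R (v + u) = bellman_lambda lam P \<mu> R v + geometric_mix lam P u"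
  unfolding bellman_lambda_def geometric_mix_def bellman_iterate_add scaleR_add_right
    suminf_add[OF summable_bellman_iterates[OF assms] summable_matrix_power_series[OF assms], symmetric] ..

lemma inner_stationary_bellman:
  assumes "stationary_dist P \<mu>"
  shows "\<mu> \<bullet> bellman P \<mu> R v = \<mu> \<bullet> v"
proof -
  have "\<mu> \<bullet> (P *v v) = \<mu> \<bullet> v" and "\<mu> \<bullet> 1 = 1"
    using assms dot_lmul_matrix[of \<mu> P v] by (simp_all add: stationary_dist_def inner_vec_def)
  then show ?thesis
    by (simp add: bellman_def avg_reward_def inner_diff_right inner_add_right)
qed

lemma inner_stationary_bellman_lambda:
  fixes P :: "real^'s^'s"
  assumes "stochastic P" "stationary_dist P \<mu>" "0 \<le> lam" "lam < 1"
  shows "\<mu> \<bullet> bellman_lambda lam P \<mu> R v = \<mu> \<bullet> v"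
proof -
  have "\<mu> \<bullet> (bellman P \<mu> R ^^ n) v = \<mu> \<bullet> v" for n
    by (induction n) (simp_all add: inner_stationary_bellman[OF assms(2)])
  then have "\<mu> \<bullet> (\<Sum>m. lam ^ m *\<^sub>R (bellman P \<mu> R ^^ (m + 1)) v) = (\<Sum>m. lam ^ m * (\<mu> \<bullet> v))"
    using bounded_linear.suminf[OF bounded_linear_inner_right summable_bellman_iterates[OF assms(1,3,4)]]
    by (simp del: funpow.simps)
  also have "\<dots> = (\<mu> \<bullet> v) / (1 - lam)"
    using suminf_geometric[of lam] assms(3,4) suminf_mult2[OF summable_geometric, of lam "\<mu> \<bullet> v"]
    by simp
  finally show ?thesis
    using assms(4) by (simp add: bellman_lambda_def)
qed

lemma linear_geometric_mix:
  fixes P :: "real^'s^'s"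
  assumes "stochastic P" "0 \<le> lam" "lam < 1"
  shows "linear (geometric_mix lam P)"
proof -
  have "linear (\<lambda>u. \<Sum>m. lam ^ m *\<^sub>R ((*v) P ^^ (m + 1)) u)"
    by (intro linear_suminf summable_matrix_power_series[OF assms] real_vector.module_hom_scale
        linear_funpow matrix_vector_mul_linear)
  then show ?thesis
    unfolding geometric_mix_def by (intro real_vector.module_hom_scale)
qed

lemma geometric_mix_one:
  fixes P :: "real^'s^'s"
  assumes "stochastic P" "0 \<le> lam" "lam < 1"
  shows "geometric_mix lam P 1 = 1"
proof -
  have "((*v) P ^^ n) 1 = (1::real^'s)" for n
    by (induction n) (simp_all add: stochastic_mult_one[OF assms(1)])
  then have "(\<Sum>m. lam ^ m *\<^sub>R ((*v) P ^^ (m + 1)) 1) = (\<Sum>m. lam ^ m) *\<^sub>R 1"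
    using suminf_scaleR_left[OF summable_geometric, of lam "1::real^'s"] assms
    by (simp del: funpow.simps)
  then show ?thesis
    unfolding geometric_mix_def using assms by (simp add: suminf_geometric)
qed

lemma bellman_lambda_add_const:
  fixes P :: "real^'s^'s"
  assumes "stochastic P" "0 \<le> lam" "lam < 1"
  shows "bellman_lambda lam P \<mu> R (v + t *\<^sub>R 1) = bellman_lambda lam P \<mu> R v + t *\<^sub>R 1"
  using bellman_lambda_add[OF assms] linear_cmul[OF linear_geometric_mix[OF assms]]
    geometric_mix_one[OF assms] by simp

lemma geometric_mix_unfold:
  fixes P :: "real^'s^'s"
  assumes "stochastic P" "0 \<le> lam" "lam < 1"
  shows "geometric_mix lam P u = (1 - lam) *\<^sub>R (P *v u) + lam *\<^sub>R (P *v geometric_mix lam P u)"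
proof -
  define f where "f m = lam ^ m *\<^sub>R ((*v) P ^^ (m + 1)) u" for m
  have sf: "summable f"
    unfolding f_def by (rule summable_matrix_power_series[OF assms])
  have "P *v suminf f = (\<Sum>m. P *v f m)"
    by (rule bounded_linear.suminf[OF matrix_vector_mul_bounded_linear sf])
  then have "lam *\<^sub>R (P *v suminf f) = (\<Sum>m. lam *\<^sub>R (P *v f m))"
    using suminf_scaleR_right[OF bounded_linear.summable[OF matrix_vector_mul_bounded_linear sf], of lam]
    by simp
  also have "\<dots> = (\<Sum>m. f (Suc m))"
    by (simp add: f_def matrix_vector_mult_scaleR)
  also have "\<dots> = suminf f - P *v u"
    using suminf_split_head[OF sf] by (simp add: f_def)
  finally have "lam *\<^sub>R (P *v suminf f) = suminf f - P *v u" .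
  then have "lam *\<^sub>R (P *v ((1 - lam) *\<^sub>R suminf f)) = (1 - lam) *\<^sub>R (suminf f - P *v u)"
    by (metis matrix_vector_mult_scaleR scaleR_left_commute)
  moreover have "geometric_mix lam P u = (1 - lam) *\<^sub>R suminf f"
    unfolding geometric_mix_def f_def ..
  ultimately show ?thesis
    by (simp add: scaleR_diff_right)
qed

section \<open>The D-weighted geometry\<close>

definition sqrtD :: "real^'s \<Rightarrow> real^'s \<Rightarrow> real^'s" where
  "sqrtD \<mu> x = (\<chi> i. sqrt (\<mu> $ i) * x $ i)"

lemma linear_sqrtD: "linear (sqrtD \<mu>)"
  by (rule linearI) (simp_all add: sqrtD_def vec_eq_iff algebra_simps)

lemma innerD_eq_inner_sqrtD:
  assumes "\<And>i. 0 \<le> \<mu> $ i"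
  shows "innerD \<mu> x y = sqrtD \<mu> x \<bullet> sqrtD \<mu> y"
  unfolding innerD_def inner_vec_def sqrtD_def
  by (intro sum.cong) (simp_all add: assms algebra_simps flip: power2_eq_square)

lemma sqrtD_eq_0_iff:
  assumes "\<And>i. 0 < \<mu> $ i"
  shows "sqrtD \<mu> x = 0 \<longleftrightarrow> x = 0"
  using assms by (auto simp: sqrtD_def vec_eq_iff) (metis less_irrefl)

lemma innerD_one: "innerD \<mu> x 1 = \<mu> \<bullet> x"
  by (simp add: innerD_def inner_vec_def)

lemma innerD_add_left: "innerD \<mu> (x + y) w = innerD \<mu> x w + innerD \<mu> y w"
  by (simp add: innerD_def sum.distrib algebra_simps)

lemma innerD_diff_left: "innerD \<mu> (x - y) w = innerD \<mu> x w - innerD \<mu> y w"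
  by (simp add: innerD_def sum_subtractf algebra_simps)

lemma innerD_scaleR_left: "innerD \<mu> (c *\<^sub>R x) w = c * innerD \<mu> x w"
  by (simp add: innerD_def sum_distrib_left algebra_simps)

lemma innerD_add_right: "innerD \<mu> w (x + y) = innerD \<mu> w x + innerD \<mu> w y"
  by (simp add: innerD_def sum.distrib algebra_simps)

lemma innerD_scaleR_right: "innerD \<mu> w (c *\<^sub>R x) = c * innerD \<mu> w x"
  by (simp add: innerD_def sum_distrib_left algebra_simps)

lemma innerD_self_eq_0_iff:
  assumes "\<And>i. 0 < \<mu> $ i"
  shows "innerD \<mu> x x = 0 \<longleftrightarrow> x = 0"
  using assms by (simp add: innerD_eq_inner_sqrtD less_imp_le sqrtD_eq_0_iff)

lemma projD_ex1:
  assumes "subspace W" "\<And>i. 0 < \<mu> $ i"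
  shows "\<exists>!y. y \<in> W \<and> (\<forall>w\<in>W. innerD \<mu> (x - y) w = 0)"
proof (rule ex_ex1I)
  have \<mu>0: "\<And>i. 0 \<le> \<mu> $ i"
    using assms(2) less_imp_le by blast
  have span_eq: "span (sqrtD \<mu> ` W) = sqrtD \<mu> ` W"
    using linear_subspace_image[OF linear_sqrtD assms(1)] by (simp add: span_eq_iff)
  obtain y' z where "y' \<in> span (sqrtD \<mu> ` W)" and z: "\<And>w. w \<in> span (sqrtD \<mu> ` W) \<Longrightarrow> orthogonal z w"
    and decomp: "sqrtD \<mu> x = y' + z"
    using orthogonal_subspace_decomp_exists[of "sqrtD \<mu> ` W" "sqrtD \<mu> x"] by blast
  then have "y' \<in> sqrtD \<mu> ` W" and z: "\<And>w. w \<in> sqrtD \<mu> ` W \<Longrightarrow> orthogonal z w"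
    unfolding span_eq by auto
  then obtain y where "y \<in> W" "y' = sqrtD \<mu> y"
    by blast
  moreover have "sqrtD \<mu> (x - y) = z"
    using decomp \<open>y' = sqrtD \<mu> y\<close> by (simp add: linear_diff[OF linear_sqrtD])
  ultimately show "\<exists>y. y \<in> W \<and> (\<forall>w\<in>W. innerD \<mu> (x - y) w = 0)"
    using z by (auto simp: innerD_eq_inner_sqrtD[OF \<mu>0] orthogonal_def)
next
  fix y1 y2
  assume y1: "y1 \<in> W \<and> (\<forall>w\<in>W. innerD \<mu> (x - y1) w = 0)"
    and y2: "y2 \<in> W \<and> (\<forall>w\<in>W. innerD \<mu> (x - y2) w = 0)"
  then have "y1 - y2 \<in> W"
    using assms(1) by (simp add: subspace_diff)
  then have "innerD \<mu> (y1 - y2) (y1 - y2) = 0"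
    using y1 y2 innerD_diff_left[of \<mu> "x - y2" "x - y1"] by simp
  then show "y1 = y2"
    using innerD_self_eq_0_iff[OF assms(2)] by simp
qed

lemma
  assumes "subspace W" "\<And>i. 0 < \<mu> $ i"
  shows projD_in: "projD \<mu> W x \<in> W"
    and projD_orthogonal: "w \<in> W \<Longrightarrow> innerD \<mu> (x - projD \<mu> W x) w = 0"
  using theI'[OF projD_ex1[OF assms, of x]] unfolding projD_def by auto

lemma projD_eq_iff:
  assumes "subspace W" "\<And>i. 0 < \<mu> $ i" "y \<in> W"
  shows "y = projD \<mu> W x \<longleftrightarrow> (\<forall>w\<in>W. innerD \<mu> (x - y) w = 0)"
proof
  assume "\<forall>w\<in>W. innerD \<mu> (x - y) w = 0"
  then show "y = projD \<mu> W x"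
    unfolding projD_def using assms(3) by (intro the1_equality[symmetric] projD_ex1[OF assms(1,2)]) simp
qed (use projD_orthogonal[OF assms(1,2)] in simp)

lemma linear_projD:
  fixes W :: "(real^'s) set"
  assumes "subspace W" "\<And>i. 0 < \<mu> $ i"
  shows "linear (projD \<mu> W)"
proof (rule linearI)
  note proj = projD_in[OF assms] projD_orthogonal[OF assms]
  fix a b :: "real^'s" and c :: real
  have add: "a + b - (projD \<mu> W a + projD \<mu> W b) = (a - projD \<mu> W a) + (b - projD \<mu> W b)"
    by simp
  have "\<forall>w\<in>W. innerD \<mu> (a + b - (projD \<mu> W a + projD \<mu> W b)) w = 0"
    unfolding add innerD_add_left using proj by simp
  then show "projD \<mu> W (a + b) = projD \<mu> W a + projD \<mu> W b"
    using projD_eq_iff[OF assms subspace_add[OF assms(1) proj(1) proj(1)]] by metis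
  have scale: "c *\<^sub>R a - c *\<^sub>R projD \<mu> W a = c *\<^sub>R (a - projD \<mu> W a)"
    by (simp add: scaleR_right_diff_distrib)
  have "\<forall>w\<in>W. innerD \<mu> (c *\<^sub>R a - c *\<^sub>R projD \<mu> W a) w = 0"
    unfolding scale innerD_scaleR_left using proj by simp
  then show "projD \<mu> W (c *\<^sub>R a) = c *\<^sub>R projD \<mu> W a"
    using projD_eq_iff[OF assms subspace_scale[OF assms(1) proj(1)]] by metis
qed

lemma weighted_mean_square_le:
  fixes p x :: "'a \<Rightarrow> real"
  assumes "finite A" "\<And>j. j \<in> A \<Longrightarrow> 0 \<le> p j" "(\<Sum>j\<in>A. p j) = 1"
  shows "(\<Sum>j\<in>A. p j * x j)\<^sup>2 \<le> (\<Sum>j\<in>A. p j * (x j)\<^sup>2)"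
proof -
  define m where "m = (\<Sum>j\<in>A. p j * x j)"
  have "0 \<le> (\<Sum>j\<in>A. p j * (x j - m)\<^sup>2)"
    using assms by (intro sum_nonneg) auto
  also have "\<dots> = (\<Sum>j\<in>A. p j * (x j)\<^sup>2) - 2 * m * m + m\<^sup>2 * (\<Sum>j\<in>A. p j)"
    by (simp add: power2_diff algebra_simps sum.distrib sum_subtractf sum_distrib_left
        sum_distrib_right m_def)
  finally show ?thesis
    using assms(3) by (simp add: m_def power2_eq_square)
qed

lemma norm_sqrtD_stochastic_le:
  assumes "stochastic P" "stationary_dist P \<mu>"
  shows "norm (sqrtD \<mu> (P *v x)) \<le> norm (sqrtD \<mu> x)"
proof -
  have \<mu>0: "\<And>i. 0 \<le> \<mu> $ i"
    using assms(2) by (simp add: stationary_dist_def)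
  have norm_sq: "(norm (sqrtD \<mu> y))\<^sup>2 = (\<Sum>i\<in>UNIV. \<mu> $ i * (y $ i)\<^sup>2)" for y
    unfolding power2_norm_eq_inner innerD_eq_inner_sqrtD[OF \<mu>0, symmetric]
    by (simp add: innerD_def power2_eq_square mult.assoc)
  have "(\<Sum>i\<in>UNIV. \<mu> $ i * ((P *v x) $ i)\<^sup>2) \<le> (\<Sum>i\<in>UNIV. \<mu> $ i * (\<Sum>j\<in>UNIV. P $ i $ j * (x $ j)\<^sup>2))"
    using assms(1) \<mu>0 weighted_mean_square_le[of UNIV "\<lambda>j. P $ _ $ j" "\<lambda>j. x $ j"]
    by (intro sum_mono mult_left_mono) (simp_all add: stochastic_def matrix_vector_mult_def)
  also have "\<dots> = (\<Sum>j\<in>UNIV. (\<mu> v* P) $ j * (x $ j)\<^sup>2)"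
    unfolding vector_matrix_mult_def sum_distrib_left sum_distrib_right vec_lambda_beta
    by (subst sum.swap) (simp add: mult.assoc)
  also have "\<dots> = (\<Sum>j\<in>UNIV. \<mu> $ j * (x $ j)\<^sup>2)"
    using assms(2) by (simp add: stationary_dist_def)
  finally have "(norm (sqrtD \<mu> (P *v x)))\<^sup>2 \<le> (norm (sqrtD \<mu> x))\<^sup>2"
    by (simp add: norm_sq)
  then show ?thesis
    by (rule power2_le_imp_le) simp
qed

lemma norm_sqrtD_geometric_mix_le:
  fixes P :: "real^'s^'s"
  assumes "stochastic P" "stationary_dist P \<mu>" "0 \<le> lam" "lam < 1"
  shows "norm (sqrtD \<mu> (geometric_mix lam P u)) \<le> norm (sqrtD \<mu> u)"
proof -
  let ?G = "geometric_mix lam P u"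
  have "norm (sqrtD \<mu> ?G) = norm ((1 - lam) *\<^sub>R sqrtD \<mu> (P *v u) + lam *\<^sub>R sqrtD \<mu> (P *v ?G))"
    by (subst geometric_mix_unfold[OF assms(1,3,4)])
      (simp add: linear_add[OF linear_sqrtD] linear_cmul[OF linear_sqrtD])
  also have "\<dots> \<le> (1 - lam) * norm (sqrtD \<mu> (P *v u)) + lam * norm (sqrtD \<mu> (P *v ?G))"
    using norm_triangle_ineq[of "(1 - lam) *\<^sub>R sqrtD \<mu> (P *v u)" "lam *\<^sub>R sqrtD \<mu> (P *v ?G)"] assms(3,4)
    by simp
  also have "\<dots> \<le> (1 - lam) * norm (sqrtD \<mu> u) + lam * norm (sqrtD \<mu> ?G)"
    using assms norm_sqrtD_stochastic_le[OF assms(1,2)] by (intro add_mono mult_left_mono) auto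
  finally have "(1 - lam) * norm (sqrtD \<mu> ?G) \<le> (1 - lam) * norm (sqrtD \<mu> u)"
    by (simp add: algebra_simps)
  then show ?thesis
    using assms(4) by simp
qed

section \<open>Irreducible stochastic matrices\<close>

lemma mat_pow_Suc: "mat_pow P (Suc n) = mat_pow P n ** P"
  by (simp add: mat_pow_def)

lemma mat_pow_nonneg:
  assumes "stochastic P"
  shows "0 \<le> mat_pow P n $ i $ j"
proof (induction n arbitrary: j)
  case 0
  show ?case by (simp add: mat_pow_def mat_def)
next
  case (Suc n)
  show ?case
    using Suc assms by (simp add: mat_pow_Suc matrix_matrix_mult_def stochastic_def sum_nonneg)
qed

lemma stationary_dist_mat_pow:
  assumes "stationary_dist P \<mu>"
  shows "\<mu> v* mat_pow P n = \<mu>"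
proof (induction n)
  case 0
  show ?case by (simp add: mat_pow_def)
next
  case (Suc n)
  then show ?case
    using assms by (simp add: mat_pow_Suc vector_matrix_mul_assoc[symmetric] stationary_dist_def)
qed

lemma stationary_dist_pos:
  assumes "stochastic P" "irreducible P" "stationary_dist P \<mu>"
  shows "0 < \<mu> $ j"
proof -
  have \<mu>0: "\<And>i. 0 \<le> \<mu> $ i"
    using assms(3) by (simp add: stationary_dist_def)
  have "\<exists>i. 0 < \<mu> $ i"
  proof (rule ccontr)
    assume "\<nexists>i. 0 < \<mu> $ i"
    then have "\<mu> = 0"
      using \<mu>0 by (simp add: vec_eq_iff not_less order_antisym)
    then show False
      using assms(3) by (simp add: stationary_dist_def)
  qed
  then obtain i where "0 < \<mu> $ i" ..
  moreover obtain n where "0 < mat_pow P n $ i $ j"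
    using assms(2) irreducible_def by blast
  moreover have "\<mu> $ i * mat_pow P n $ i $ j \<le> (\<Sum>k\<in>UNIV. \<mu> $ k * mat_pow P n $ k $ j)"
    using \<mu>0 mat_pow_nonneg[OF assms(1)] by (intro member_le_sum) auto
  moreover have "(\<Sum>k\<in>UNIV. \<mu> $ k * mat_pow P n $ k $ j) = \<mu> $ j"
    using arg_cong[OF stationary_dist_mat_pow[OF assms(3), of n], of "\<lambda>v. v $ j"]
    by (simp add: vector_matrix_mult_def)
  ultimately show ?thesis
    using mult_pos_pos order_less_le_trans by metis
qed

lemma harmonic_max_step:
  assumes "stochastic P" "P *v v = v" "\<And>k. v $ k \<le> v $ j" "0 < P $ j $ k"
  shows "v $ k = v $ j"
proof -
  have "(\<Sum>k\<in>UNIV. P $ j $ k * (v $ j - v $ k)) = v $ j * (\<Sum>k\<in>UNIV. P $ j $ k) - (P *v v) $ j"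
    by (simp add: algebra_simps sum_subtractf sum_distrib_left matrix_vector_mult_def)
  also have "\<dots> = 0"
    using assms(1,2) by (simp add: stochastic_def)
  finally have "P $ j $ k * (v $ j - v $ k) = 0"
    using assms(1,3) sum_nonneg_eq_0_iff[of UNIV "\<lambda>k. P $ j $ k * (v $ j - v $ k)"]
    by (simp add: stochastic_def)
  then show ?thesis
    using assms(4) by simp
qed

lemma harmonic_max_mat_pow:
  assumes "stochastic P" "P *v v = v" "\<And>k. v $ k \<le> v $ i" "0 < mat_pow P n $ i $ k"
  shows "v $ k = v $ i"
  using assms(4)
proof (induction n arbitrary: k)
  case 0
  then show ?case by (simp add: mat_pow_def mat_def split: if_splits)
next
  case (Suc n)
  then have "0 < (\<Sum>j\<in>UNIV. mat_pow P n $ i $ j * P $ j $ k)"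
    by (simp add: mat_pow_Suc matrix_matrix_mult_def)
  then obtain j where "0 < mat_pow P n $ i $ j * P $ j $ k"
    by (meson not_le sum_nonpos)
  then have ij: "0 < mat_pow P n $ i $ j" and jk: "0 < P $ j $ k"
    using mat_pow_nonneg[OF assms(1), of n i j] by (simp_all add: zero_less_mult_iff)
  from ij have "v $ j = v $ i"
    by (rule Suc.IH)
  then show ?case
    using harmonic_max_step[OF assms(1,2) _ jk] assms(3) by simp
qed

lemma irreducible_harmonic_const:
  assumes "stochastic P" "irreducible P" "P *v v = v"
  shows "\<exists>t. v = t *\<^sub>R 1"
proof -
  have "Max (range (\<lambda>k. v $ k)) \<in> range (\<lambda>k. v $ k)"
    by (rule Max_in) auto
  then obtain i where "v $ i = Max (range (\<lambda>k. v $ k))"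
    by (metis imageE)
  then have max: "\<And>k. v $ k \<le> v $ i"
    by simp
  have "v $ k = v $ i" for k
    using assms(2) harmonic_max_mat_pow[OF assms(1,3) max] unfolding irreducible_def by blast
  then have "v = v $ i *\<^sub>R 1"
    by (simp add: vec_eq_iff)
  then show ?thesis ..
qed

section \<open>The projected Bellman equation\<close>

lemma geometric_mix_fixed_imp_harmonic:
  fixes P :: "real^'s^'s"
  assumes "stochastic P" "0 \<le> lam" "lam < 1" "geometric_mix lam P v = v"
  shows "P *v v = v"
  using geometric_mix_unfold[OF assms(1-3), of v] assms(4) by (simp add: scaleR_add_left[symmetric])

lemma projD_fixed_imp_geometric_mix_fixed:
  fixes P :: "real^'s^'s"
  assumes "stochastic P" "stationary_dist P \<mu>" "0 \<le> lam" "lam < 1"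
    and "subspace W" "\<And>i. 0 < \<mu> $ i" "v \<in> W" "v = projD \<mu> W (geometric_mix lam P v)"
  shows "geometric_mix lam P v = v"
proof -
  let ?G = "geometric_mix lam P v"
  have "innerD \<mu> (?G - v) v = 0"
    using projD_orthogonal[OF assms(5,6) assms(7), of ?G] assms(8) by simp
  then have "sqrtD \<mu> (?G - v) \<bullet> sqrtD \<mu> v = 0"
    using assms(6) by (simp add: innerD_eq_inner_sqrtD less_imp_le)
  then have "(norm (sqrtD \<mu> ?G))\<^sup>2 = (norm (sqrtD \<mu> (?G - v)))\<^sup>2 + (norm (sqrtD \<mu> v))\<^sup>2"
    using norm_add_Pythagorean[of "sqrtD \<mu> (?G - v)" "sqrtD \<mu> v"]
    by (simp add: linear_diff[OF linear_sqrtD] orthogonal_def)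
  moreover have "(norm (sqrtD \<mu> ?G))\<^sup>2 \<le> (norm (sqrtD \<mu> v))\<^sup>2"
    using norm_sqrtD_geometric_mix_le[OF assms(1-4)] by (simp add: power_mono)
  ultimately have "sqrtD \<mu> (?G - v) = 0"
    by simp
  then show ?thesis
    using sqrtD_eq_0_iff[OF assms(6)] by simp
qed

lemma linear_fixed_point_free_imp_ex1:
  fixes L :: "'a::euclidean_space \<Rightarrow> 'a"
  assumes "subspace W" "linear L" "L ` W \<subseteq> W" "\<And>v. v \<in> W \<Longrightarrow> L v = v \<Longrightarrow> v = 0" "c \<in> W"
  shows "\<exists>!v. v \<in> W \<and> v = c + L v"
proof -
  define M where "M v = v - L v" for v
  have "linear M"
    unfolding M_def by (intro linear_compose_sub linear_ident assms(2))
  have MW: "M ` W \<subseteq> W"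
    using assms(1,3) by (auto simp: M_def intro: subspace_diff)
  have "inj_on M W"
  proof (rule inj_onI)
    fix a b assume "a \<in> W" "b \<in> W" "M a = M b"
    then have "L (a - b) = a - b"
      by (simp add: M_def linear_diff[OF assms(2)] algebra_simps)
    with subspace_diff[OF assms(1) \<open>a \<in> W\<close> \<open>b \<in> W\<close>] have "a - b = 0"
      by (rule assms(4))
    then show "a = b"
      by simp
  qed
  moreover have "span W = W"
    using assms(1) by (simp add: span_eq_iff)
  ultimately have "dim (M ` W) = dim W"
    using dim_image_eq[OF \<open>linear M\<close>, of W] by metis
  then have "M ` W = W"
    using subspace_dim_equal[OF linear_subspace_image[OF \<open>linear M\<close> assms(1)] assms(1) MW] by simp
  then obtain v where v: "v \<in> W" "M v = c"
    using assms(5) by (metis imageE)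
  have fixed_iff: "u = c + L u \<longleftrightarrow> M u = c" for u
    by (auto simp: M_def diff_eq_eq)
  show ?thesis
  proof (rule ex1I[of _ v])
    show "v \<in> W \<and> v = c + L v"
      using v fixed_iff by simp
    fix u assume "u \<in> W \<and> u = c + L u"
    then show "u = v"
      using v fixed_iff inj_onD[OF \<open>inj_on M W\<close>, of u v] by simp
  qed
qed

lemma projD_geometric_mix_fixed_eq_0:
  fixes P :: "real^'s^'s"
  assumes "stochastic P" "irreducible P" "stationary_dist P \<mu>" "0 \<le> lam" "lam < 1"
    and "subspace W" "1 \<notin> W" "v \<in> W" "v = projD \<mu> W (geometric_mix lam P v)"
  shows "v = 0"
proof -
  have "geometric_mix lam P v = v"
    using projD_fixed_imp_geometric_mix_fixed[OF assms(1,3-6) stationary_dist_pos[OF assms(1-3)] assms(8,9)] .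
  then have "P *v v = v"
    by (rule geometric_mix_fixed_imp_harmonic[OF assms(1,4,5)])
  then obtain t where t: "v = t *\<^sub>R 1"
    using irreducible_harmonic_const[OF assms(1,2)] by blast
  have "t = 0"
  proof (rule ccontr)
    assume "t \<noteq> 0"
    then have "(1 / t) *\<^sub>R v = 1"
      using t by simp
    then show False
      using subspace_scale[OF assms(6,8), of "1 / t"] assms(7) by simp
  qed
  then show "v = 0"
    using t by simp
qed

lemma projected_bellman_ex1:
  fixes P :: "real^'s^'s"
  assumes "stochastic P" "irreducible P" "stationary_dist P \<mu>" "0 \<le> lam" "lam < 1"
    and "subspace W" "1 \<notin> W"
  shows "\<exists>!v. v \<in> W \<and> v = projD \<mu> W (bellman_lambda lam P \<mu> R v)"
proof -
  have \<mu>: "\<And>i. 0 < \<mu> $ i"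
    using stationary_dist_pos[OF assms(1-3)] .
  define L where "L = projD \<mu> W \<circ> geometric_mix lam P"
  define c where "c = projD \<mu> W (bellman_lambda lam P \<mu> R 0)"
  have lin: "linear (projD \<mu> W)" "linear (geometric_mix lam P)"
    using linear_projD[OF assms(6) \<mu>] linear_geometric_mix[OF assms(1,4,5)] .
  have "linear L"
    unfolding L_def using linear_compose[OF lin(2,1)] .
  moreover have "L ` W \<subseteq> W"
    using projD_in[OF assms(6) \<mu>] by (auto simp: L_def)
  moreover have "v = 0" if "v \<in> W" "L v = v" for v
    using projD_geometric_mix_fixed_eq_0[OF assms that(1)] that(2) by (simp add: L_def)
  ultimately have "\<exists>!v. v \<in> W \<and> v = c + L v"
    unfolding c_def by (intro linear_fixed_point_free_imp_ex1[OF assms(6)] projD_in[OF assms(6) \<mu>])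
  moreover have "projD \<mu> W (bellman_lambda lam P \<mu> R v) = c + L v" for v
    using bellman_lambda_add[OF assms(1,4,5), of \<mu> R 0 v] linear_add[OF lin(1)] by (simp add: L_def c_def)
  ultimately show ?thesis
    by simp
qed

lemma projected_bellman_shift_const_iff:
  fixes P :: "real^'s^'s"
  assumes "stochastic P" "stationary_dist P \<mu>" "0 \<le> lam" "lam < 1" "\<And>i. 0 < \<mu> $ i"
    and "subspace W" "subspace W'" "W \<subseteq> W'" "\<And>w. w \<in> W' \<Longrightarrow> \<exists>u t. u \<in> W \<and> w = u + t *\<^sub>R 1"
    and "v \<in> W" "v + t *\<^sub>R 1 \<in> W'"
  shows "v + t *\<^sub>R 1 = projD \<mu> W' (bellman_lambda lam P \<mu> R (v + t *\<^sub>R 1))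
    \<longleftrightarrow> v = projD \<mu> W (bellman_lambda lam P \<mu> R v)"
proof -
  define r where "r = bellman_lambda lam P \<mu> R v - v"
  have "innerD \<mu> r 1 = 0"
    using inner_stationary_bellman_lambda[OF assms(1-4)] by (simp add: r_def innerD_one inner_diff_right)
  then have orth_iff: "(\<forall>w\<in>W'. innerD \<mu> r w = 0) \<longleftrightarrow> (\<forall>w\<in>W. innerD \<mu> r w = 0)"
    using assms(8,9) by (fastforce simp: innerD_add_right innerD_scaleR_right)
  have residual: "bellman_lambda lam P \<mu> R (v + t *\<^sub>R 1) - (v + t *\<^sub>R 1) = r"
    by (simp add: bellman_lambda_add_const[OF assms(1,3,4)] r_def)
  show ?thesis
    unfolding projD_eq_iff[OF assms(7,5,11)] projD_eq_iff[OF assms(6,5,10)] residual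
      r_def[symmetric]
    by (rule orth_iff)
qed

section \<open>Feature subspaces\<close>

lemma S_Phi_e_image_const:
  assumes "s \<in> S_Phi_e \<Phi>"
  shows "\<exists>t. \<Phi> *v s = t *\<^sub>R 1"
proof -
  have "\<Phi> *v s \<in> (*v) \<Phi> ` span {\<theta>. \<Phi> *v \<theta> = 1}"
    using assms by (simp add: S_Phi_e_def)
  also have "\<dots> = span ((*v) \<Phi> ` {\<theta>. \<Phi> *v \<theta> = 1})"
    by (rule linear_span_image[OF matrix_vector_mul_linear, symmetric])
  also have "\<dots> \<subseteq> span {1}"
    by (rule span_mono) auto
  finally show ?thesis
    by (auto simp: span_singleton)
qed

lemma subspace_E_Phi_e: "subspace (E_Phi_e \<Phi>)"
  by (auto simp: subspace_def E_Phi_e_def inner_add_left)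

lemma E_Phi_e_inter_S_Phi_e:
  assumes "\<theta> \<in> E_Phi_e \<Phi>" "\<theta> \<in> S_Phi_e \<Phi>"
  shows "\<theta> = 0"
  using assms by (auto simp: E_Phi_e_def)

lemma E_Phi_e_S_Phi_e_decomp:
  obtains \<eta> s where "\<eta> \<in> E_Phi_e \<Phi>" "s \<in> S_Phi_e \<Phi>" "\<theta> = \<eta> + s"
proof -
  obtain s \<eta> where "s \<in> S_Phi_e \<Phi>" "\<And>w. w \<in> S_Phi_e \<Phi> \<Longrightarrow> orthogonal \<eta> w" "\<theta> = s + \<eta>"
    using orthogonal_subspace_decomp_exists[of "{\<theta>. \<Phi> *v \<theta> = 1}" \<theta>] unfolding S_Phi_e_def by blast
  then show ?thesis
    using that[of \<eta> s] by (simp add: E_Phi_e_def orthogonal_def)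
qed

lemma one_notin_W_span_E_Phi_e: "1 \<notin> W_span \<Phi> (E_Phi_e \<Phi>)"
proof
  assume "1 \<in> W_span \<Phi> (E_Phi_e \<Phi>)"
  then obtain \<eta> where "\<eta> \<in> E_Phi_e \<Phi>" "\<Phi> *v \<eta> = 1"
    by (auto simp: W_span_def)
  moreover from this(2) have "\<eta> \<in> S_Phi_e \<Phi>"
    by (simp add: S_Phi_e_def span_base)
  ultimately show False
    using E_Phi_e_inter_S_Phi_e by fastforce
qed

lemma subspace_W_span:
  assumes "subspace E"
  shows "subspace (W_span \<Phi> E)"
  unfolding W_span_def by (rule linear_subspace_image[OF matrix_vector_mul_linear assms])

lemma W_span_UNIV_decomp:
  assumes "w \<in> W_span \<Phi> UNIV"
  shows "\<exists>u t. u \<in> W_span \<Phi> (E_Phi_e \<Phi>) \<and> w = u + t *\<^sub>R 1"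
proof -
  obtain \<theta> where "w = \<Phi> *v \<theta>"
    using assms by (auto simp: W_span_def)
  moreover obtain \<eta> s where "\<eta> \<in> E_Phi_e \<Phi>" "s \<in> S_Phi_e \<Phi>" "\<theta> = \<eta> + s"
    by (rule E_Phi_e_S_Phi_e_decomp)
  moreover obtain t where "\<Phi> *v s = t *\<^sub>R 1"
    using S_Phi_e_image_const[OF \<open>s \<in> S_Phi_e \<Phi>\<close>] ..
  ultimately show ?thesis
    by (auto simp: W_span_def matrix_vector_right_distrib)
qed

lemma projected_bellman_add_S_Phi_e_iff:
  fixes P :: "real^'s^'s" and \<Phi> :: "real^'d^'s"
  assumes "stochastic P" "stationary_dist P \<mu>" "0 \<le> lam" "lam < 1" "\<And>i. 0 < \<mu> $ i"
    and "\<eta> \<in> E_Phi_e \<Phi>" "s \<in> S_Phi_e \<Phi>"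
  shows "\<Phi> *v (\<eta> + s) = projD \<mu> (W_span \<Phi> UNIV) (bellman_lambda lam P \<mu> R (\<Phi> *v (\<eta> + s)))
    \<longleftrightarrow> \<Phi> *v \<eta> = projD \<mu> (W_span \<Phi> (E_Phi_e \<Phi>)) (bellman_lambda lam P \<mu> R (\<Phi> *v \<eta>))"
proof -
  obtain t where "\<Phi> *v s = t *\<^sub>R 1"
    using S_Phi_e_image_const[OF assms(7)] ..
  then have "\<Phi> *v (\<eta> + s) = \<Phi> *v \<eta> + t *\<^sub>R 1"
    by (simp add: matrix_vector_right_distrib)
  moreover have "W_span \<Phi> (E_Phi_e \<Phi>) \<subseteq> W_span \<Phi> UNIV" "\<Phi> *v \<eta> \<in> W_span \<Phi> (E_Phi_e \<Phi>)"
    using assms(6) by (auto simp: W_span_def)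
  moreover have "\<Phi> *v (\<eta> + s) \<in> W_span \<Phi> UNIV"
    by (simp add: W_span_def)
  ultimately show ?thesis
    using projected_bellman_shift_const_iff[OF assms(1-5) subspace_W_span[OF subspace_E_Phi_e]
        subspace_W_span[OF subspace_UNIV] _ W_span_UNIV_decomp]
    by simp
qed

lemma projected_bellman_E_Phi_e_unique_solution:
  fixes P :: "real^'s^'s" and \<Phi> :: "real^'d^'s"
  assumes "stochastic P" "irreducible P" "stationary_dist P \<mu>" "0 \<le> lam" "lam < 1"
    and "inj ((*v) \<Phi>)"
  obtains \<theta>s where "\<theta>s \<in> E_Phi_e \<Phi>"
    and "\<And>\<eta>. \<eta> \<in> E_Phi_e \<Phi> \<Longrightarrow>
      \<Phi> *v \<eta> = projD \<mu> (W_span \<Phi> (E_Phi_e \<Phi>)) (bellman_lambda lam P \<mu> R (\<Phi> *v \<eta>)) \<longleftrightarrow> \<eta> = \<theta>s"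
proof -
  let ?W = "W_span \<Phi> (E_Phi_e \<Phi>)" and ?T = "bellman_lambda lam P \<mu> R"
  obtain v where v: "v \<in> ?W \<and> v = projD \<mu> ?W (?T v)"
    and v_unique: "\<forall>u. u \<in> ?W \<and> u = projD \<mu> ?W (?T u) \<longrightarrow> u = v"
    using projected_bellman_ex1[OF assms(1-5) subspace_W_span[OF subspace_E_Phi_e]
        one_notin_W_span_E_Phi_e] by (rule ex1E)
  from v obtain \<theta>s where \<theta>s: "\<theta>s \<in> E_Phi_e \<Phi>" "v = \<Phi> *v \<theta>s"
    by (auto simp: W_span_def)
  have "\<Phi> *v \<eta> = projD \<mu> ?W (?T (\<Phi> *v \<eta>)) \<longleftrightarrow> \<eta> = \<theta>s" if "\<eta> \<in> E_Phi_e \<Phi>" for \<eta>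
  proof
    assume "\<Phi> *v \<eta> = projD \<mu> ?W (?T (\<Phi> *v \<eta>))"
    moreover have "\<Phi> *v \<eta> \<in> ?W"
      using that by (simp add: W_span_def)
    ultimately have "\<Phi> *v \<eta> = \<Phi> *v \<theta>s"
      using v_unique \<theta>s(2) by blast
    then show "\<eta> = \<theta>s"
      using assms(6) by (simp add: inj_eq)
  qed (use v \<theta>s in simp)
  with \<theta>s(1) show ?thesis
    by (rule that)
qed

lemma projected_bellman_solution_set:
  fixes P :: "real^'s^'s" and \<Phi> :: "real^'d^'s"
  assumes "stochastic P" "stationary_dist P \<mu>" "0 \<le> lam" "lam < 1" "\<And>i. 0 < \<mu> $ i"
    and "\<theta>s \<in> E_Phi_e \<Phi>"
    and "\<And>\<eta>. \<eta> \<in> E_Phi_e \<Phi> \<Longrightarrow>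
      \<Phi> *v \<eta> = projD \<mu> (W_span \<Phi> (E_Phi_e \<Phi>)) (bellman_lambda lam P \<mu> R (\<Phi> *v \<eta>)) \<longleftrightarrow> \<eta> = \<theta>s"
  shows "{\<theta>. \<Phi> *v \<theta> = projD \<mu> (W_span \<Phi> UNIV) (bellman_lambda lam P \<mu> R (\<Phi> *v \<theta>))}
    = {\<theta>s + s | s. s \<in> S_Phi_e \<Phi>}"
proof (intro set_eqI iffI)
  fix \<theta> assume "\<theta> \<in> {\<theta>. \<Phi> *v \<theta> = projD \<mu> (W_span \<Phi> UNIV) (bellman_lambda lam P \<mu> R (\<Phi> *v \<theta>))}"
  moreover obtain \<eta> s where "\<eta> \<in> E_Phi_e \<Phi>" "s \<in> S_Phi_e \<Phi>" "\<theta> = \<eta> + s"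
    by (rule E_Phi_e_S_Phi_e_decomp)
  ultimately have "\<eta> = \<theta>s"
    using projected_bellman_add_S_Phi_e_iff[OF assms(1-5) \<open>\<eta> \<in> E_Phi_e \<Phi>\<close> \<open>s \<in> S_Phi_e \<Phi>\<close>]
      assms(7)[OF \<open>\<eta> \<in> E_Phi_e \<Phi>\<close>] by simp
  then show "\<theta> \<in> {\<theta>s + s | s. s \<in> S_Phi_e \<Phi>}"
    using \<open>s \<in> S_Phi_e \<Phi>\<close> \<open>\<theta> = \<eta> + s\<close> by blast
next
  fix \<theta> assume "\<theta> \<in> {\<theta>s + s | s. s \<in> S_Phi_e \<Phi>}"
  then obtain s where "s \<in> S_Phi_e \<Phi>" "\<theta> = \<theta>s + s"
    by blast
  then show "\<theta> \<in> {\<theta>. \<Phi> *v \<theta> = projD \<mu> (W_span \<Phi> UNIV) (bellman_lambda lam P \<mu> R (\<Phi> *v \<theta>))}"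
    using projected_bellman_add_S_Phi_e_iff[OF assms(1-6)] assms(7)[OF assms(6)] by simp
qed

theorem lemma3:
  fixes P :: "real^'s^'s" and \<mu> R :: "real^'s" and lam :: real and \<Phi> :: "real^'d^'s"
  assumes "stochastic P" and "irreducible P" and "aperiodic P"
    and "stationary_dist P \<mu>"
    and "0 \<le> lam" and "lam < 1"
    and "rank \<Phi> = CARD('d)"
  shows "\<exists>\<theta>s. \<theta>s \<in> E_Phi_e \<Phi>
            \<and> \<Phi> *v \<theta>s = projD \<mu> (W_span \<Phi> (E_Phi_e \<Phi>)) (bellman_lambda lam P \<mu> R (\<Phi> *v \<theta>s))
            \<and> (\<forall>\<theta>'. \<theta>' \<in> E_Phi_e \<Phi>
                 \<and> \<Phi> *v \<theta>' = projD \<mu> (W_span \<Phi> (E_Phi_e \<Phi>)) (bellman_lambda lam P \<mu> R (\<Phi> *v \<theta>'))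
                 \<longrightarrow> \<theta>' = \<theta>s)
            \<and> {\<theta>. \<Phi> *v \<theta> = projD \<mu> (W_span \<Phi> UNIV) (bellman_lambda lam P \<mu> R (\<Phi> *v \<theta>))}
              = {\<theta>s + s | s. s \<in> S_Phi_e \<Phi>}"
proof -
  obtain \<theta>s where \<theta>s: "\<theta>s \<in> E_Phi_e \<Phi>"
    and solution_iff: "\<And>\<eta>. \<eta> \<in> E_Phi_e \<Phi> \<Longrightarrow>
      \<Phi> *v \<eta> = projD \<mu> (W_span \<Phi> (E_Phi_e \<Phi>)) (bellman_lambda lam P \<mu> R (\<Phi> *v \<eta>)) \<longleftrightarrow> \<eta> = \<theta>s"
    using projected_bellman_E_Phi_e_unique_solution[OF assms(1,2,4-6) full_rank_injective[THEN iffD1, OF assms(7)]]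
    by blast
  moreover have "{\<theta>. \<Phi> *v \<theta> = projD \<mu> (W_span \<Phi> UNIV) (bellman_lambda lam P \<mu> R (\<Phi> *v \<theta>))}
      = {\<theta>s + s | s. s \<in> S_Phi_e \<Phi>}"
    using projected_bellman_solution_set[OF assms(1,4-6) stationary_dist_pos[OF assms(1,2,4)] \<theta>s solution_iff] .
  ultimately show ?thesis
    by blast
qed

end
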